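(* Let $X$ be a completely regular topological space and let $\alpha$ be a topology on $C(X,\$)$ such that $p(X)\subseteq\alpha\subseteq\kappa(X)$. Then $$\alpha L(X)=t(\alpha(X,\$),X)=t(C_\alpha(X,\mathbb{R}),\overline{0}),$$ where $\overline 0$ is the zero function.
   Context: $C(X,\$)$ is the set of open subsets of $X$. For $A\subseteq X$, $\mathcal O_X(A)$ is the set of open sets containing $A$, and $\mathcal O_X(\mathcal A)=\bigcup_{A\in\mathcal A}\mathcal O_X(A)$. $p(X)$ is the topology on $C(X,\$)$ whose open sets are the unions of families $\mathcal O_X(F)$ with $F\subseteq X$ finite. A family $\mathcal A\subseteq C(X,\$)$ is compact if $\mathcal A=\mathcal O_X(\mathcal A)$ and whenever $\mathcal Q\subseteq C(X,\$)$ and $\bigcup\mathcal Q\in\mathcal A$, there is a finite $\mathcal S\subseteq\mathcal Q$ with $\bigcup\mathcal S\in\mathcal A$; $\kappa(X)$ is the collection (a topology) of all compact families. $\alpha(X,\$)$ is $C(X,\$)$ with the topology generated by $\alpha$. $C_\alpha(X,\mathbb R)$ is $C(X,\mathbb R)$ with the topology having as subbase the sets $[\mathcal A,U]=\{f:f^{-1}(U)\in\mathcal A\}$, $\mathcal A\in\alpha$, $U\subseteq\mathbb R$ open. For an open $U\subseteq X$, a family $\mathcal P\subseteq C(X,\$)$ is an (open) $\alpha$-cover of $U$ if $\mathcal P\cap\mathcal A\ne\varnothing$ for every $\mathcal A\in\alpha$ with $U\in\mathcal A$. The $\alpha$-Lindelöf number $\alpha L(U)$ is the smallest cardinal $\lambda$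 such that every open $\alpha$-cover of $U$ contains an $\alpha$-cover of $U$ of cardinality at most $\lambda$. $t(Y,y)$ is the tightness of the topological space $Y$ at $y$: the least $\lambda$ such that whenever $y\in\mathrm{cl}\,A$ there is $B\subseteq A$ with $|B|\le\lambda$ and $y\in\mathrm{cl}\,B$. All cardinal functions are understood to be infinite (at least $\omega$). *)

theory Defs
  imports "HOL-Analysis.Analysis"
begin

unbundle cardinal_syntax

text \<open>\<open>=o\<close> is used for \<open>ordIso\<close> only.\<close>

no_notation elt_set_eq (infix \<open>=o\<close> 50)

text \<open>
  The least infinite cardinal satisfying a property.  Cardinals are the cardinal orders of
  the BNF library, so the value is determined up to \<open>=o\<close> only, and equality of two cardinal
  functions is stated as \<open>=o\<close>.  The type parameter bounds the cardinals which are considered; for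
  the cardinal functions below it is chosen so large that the minimum over it is the minimum
  over the cardinals of every type (lemmas \<open>tightness_least\<close> and \<open>alpha_Lindelof_number_least\<close>).
\<close>

definition least_infinite_card :: "('c rel \<Rightarrow> bool) \<Rightarrow> 'c rel" where
  "least_infinite_card P =
     (SOME r. Cinfinite r \<and> P r \<and> (\<forall>s. Cinfinite s \<and> P s \<longrightarrow> r \<le>o s))"

definition tight_at :: "'b topology \<Rightarrow> 'b \<Rightarrow> 'c rel \<Rightarrow> bool" where
  "tight_at Y y r \<longleftrightarrow>
     (\<forall>A. A \<subseteq> topspace Y \<and> y \<in> Y closure_of A \<longrightarrow>
        (\<exists>B. B \<subseteq> A \<and> |B| \<le>o r \<and> y \<in> Y closure_of B))"

text \<open>The summand \<open>nat\<close> guarantees that there is an infinite cardinal on the type.\<close>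

definition tightness :: "'b topology \<Rightarrow> 'b \<Rightarrow> ('b + nat) rel" where
  "tightness Y y = least_infinite_card (tight_at Y y)"

definition opens :: "'a topology \<Rightarrow> 'a set set" where
  "opens X = {U. openin X U}"

definition nbhds :: "'a topology \<Rightarrow> 'a set \<Rightarrow> 'a set set" where
  "nbhds X A = {U. openin X U \<and> A \<subseteq> U}"

definition nbhds_fam :: "'a topology \<Rightarrow> 'a set set \<Rightarrow> 'a set set" where
  "nbhds_fam X \<A> = (\<Union>A\<in>\<A>. nbhds X A)"

definition p_top :: "'a topology \<Rightarrow> 'a set set set" where
  "p_top X = {\<Union>F\<in>\<F>. nbhds X F |\<F>. \<forall>F\<in>\<F>. finite F \<and> F \<subseteq> topspace X}"

definition compact_family :: "'a topology \<Rightarrow> 'a set set \<Rightarrow> bool" where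
  "compact_family X \<A> \<longleftrightarrow>
     \<A> \<subseteq> opens X \<and> \<A> = nbhds_fam X \<A> \<and>
     (\<forall>\<Q>. \<Q> \<subseteq> opens X \<and> \<Union>\<Q> \<in> \<A> \<longrightarrow> (\<exists>\<S>. finite \<S> \<and> \<S> \<subseteq> \<Q> \<and> \<Union>\<S> \<in> \<A>))"

definition kappa_top :: "'a topology \<Rightarrow> 'a set set set" where
  "kappa_top X = {\<A>. compact_family X \<A>}"

text \<open>
  Here \<open>\<alpha>\<close> is a topology on \<open>opens X\<close>; as a value of type \<open>'a set topology\<close> it is at the same
  time the space \<open>\<alpha>(X,$)\<close>.
\<close>

definition alpha_cover :: "'a topology \<Rightarrow> 'a set topology \<Rightarrow> 'a set \<Rightarrow> 'a set set \<Rightarrow> bool" where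
  "alpha_cover X \<alpha> U \<P> \<longleftrightarrow>
     \<P> \<subseteq> opens X \<and> (\<forall>\<A>. openin \<alpha> \<A> \<and> U \<in> \<A> \<longrightarrow> \<P> \<inter> \<A> \<noteq> {})"

definition alpha_Lindelof :: "'a topology \<Rightarrow> 'a set topology \<Rightarrow> 'a set \<Rightarrow> 'c rel \<Rightarrow> bool" where
  "alpha_Lindelof X \<alpha> U r \<longleftrightarrow>
     (\<forall>\<P>. alpha_cover X \<alpha> U \<P> \<longrightarrow>
        (\<exists>\<R>. \<R> \<subseteq> \<P> \<and> |\<R>| \<le>o r \<and> alpha_cover X \<alpha> U \<R>))"

definition alpha_Lindelof_number ::
    "'a topology \<Rightarrow> 'a set topology \<Rightarrow> 'a set \<Rightarrow> ('a set + nat) rel" where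
  "alpha_Lindelof_number X \<alpha> U = least_infinite_card (alpha_Lindelof X \<alpha> U)"

text \<open>
  Continuous functions on \<open>X\<close> are represented by their extensional representatives, so that
  functions agreeing on \<open>topspace X\<close> are equal.
\<close>

definition cont_real :: "'a topology \<Rightarrow> ('a \<Rightarrow> real) set" where
  "cont_real X = {f \<in> extensional (topspace X). continuous_map X euclideanreal f}"

definition fun_subbasic :: "'a topology \<Rightarrow> 'a set set \<Rightarrow> real set \<Rightarrow> ('a \<Rightarrow> real) set" where
  "fun_subbasic X \<A> U = {f \<in> cont_real X. {x \<in> topspace X. f x \<in> U} \<in> \<A>}"

definition C_alpha :: "'a topology \<Rightarrow> 'a set topology \<Rightarrow> ('a \<Rightarrow> real) topology" where
  "C_alpha X \<alpha> =
     topology_generated_by {fun_subbasic X \<A> U |\<A> U. openin \<alpha> \<A> \<and> open U}"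

definition zero_fun :: "'a topology \<Rightarrow> 'a \<Rightarrow> real" where
  "zero_fun X = (\<lambda>x\<in>topspace X. 0)"

lemma least_infinite_card:
  assumes "Cinfinite r0" "P r0"
  shows "Cinfinite (least_infinite_card P)" "P (least_infinite_card P)"
    "\<And>s. Cinfinite s \<Longrightarrow> P s \<Longrightarrow> least_infinite_card P \<le>o s"
proof -
  let ?R = "{r. Cinfinite r \<and> P r}"
  have "\<exists>r\<in>?R. \<forall>s\<in>?R. r \<le>o s"
    using assms by (intro exists_minim_Well_order) (auto simp: card_order_on_well_order_on)
  then have "\<exists>r. Cinfinite r \<and> P r \<and> (\<forall>s. Cinfinite s \<and> P s \<longrightarrow> r \<le>o s)"
    by blast
  from someI_ex[OF this]
  show "Cinfinite (least_infinite_card P)" "P (least_infinite_card P)"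
    "\<And>s. Cinfinite s \<Longrightarrow> P s \<Longrightarrow> least_infinite_card P \<le>o s"
    unfolding least_infinite_card_def by blast+
qed

lemma Cinfinite_UNIV_plus: "Cinfinite |UNIV :: ('b + nat) set|"
proof
  show "cinfinite |UNIV :: ('b + nat) set|"
    unfolding cinfinite_def Field_card_of by simp
  show "Card_order |UNIV :: ('b + nat) set|"
    by (rule card_of_Card_order)
qed

lemma least_infinite_card_all_types:
  fixes P :: "('b + nat) rel \<Rightarrow> bool" and s :: "'d rel"
  assumes UNIV: "P |UNIV|" and s: "Cinfinite s" and transfer: "\<And>r. s \<le>o r \<Longrightarrow> P r"
  shows "least_infinite_card P \<le>o s"
proof -
  have inf: "Cinfinite |UNIV :: ('b + nat) set|"
    by (rule Cinfinite_UNIV_plus)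
  show ?thesis
  proof (cases "|UNIV :: ('b + nat) set| \<le>o s")
    case True
    with least_infinite_card(3)[of _ P, OF inf UNIV inf UNIV] show ?thesis
      by (rule ordLeq_transitive)
  next
    case False
    then have "s \<le>o |UNIV :: ('b + nat) set|"
      using s inf ordLeq_total[of s "|UNIV :: ('b + nat) set|"]
      by (simp add: card_order_on_well_order_on)
    moreover have fs: "|Field s| =o s"
      using s by (simp add: card_of_Field_ordIso)
    ultimately have "|Field s| \<le>o |UNIV :: ('b + nat) set|"
      by (rule_tac ordIso_ordLeq_trans)
    then obtain B :: "('b + nat) set" where "|Field s| =o |B|"
      unfolding internalize_card_of_ordLeq2[of "Field s"] by (elim exE conjE)
    with ordIso_symmetric[OF fs] have B: "s =o |B|"
      by (rule ordIso_transitive)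
    have "least_infinite_card P \<le>o |B|"
      by (rule least_infinite_card(3)[of _ P, OF inf UNIV Cinfinite_cong[OF B s]
            transfer[OF ordIso_imp_ordLeq[OF B]]])
    then show ?thesis
      using ordIso_symmetric[OF B] by (rule ordLeq_ordIso_trans)
  qed
qed

lemma card_of_ordLeq_UNIV_plus: "|A :: 'b set| \<le>o |UNIV :: ('b + nat) set|"
  by (rule card_of_ordLeqI[of Inl]) auto

lemma tight_at_UNIV: "tight_at Y (y :: 'b) |UNIV :: ('b + nat) set|"
  unfolding tight_at_def using card_of_ordLeq_UNIV_plus by blast

lemma tight_at_mono: "tight_at Y y s \<Longrightarrow> s \<le>o r \<Longrightarrow> tight_at Y y r"
  unfolding tight_at_def by (metis ordLeq_transitive)

lemma tightness: "Cinfinite (tightness Y y)" "tight_at Y y (tightness Y y)"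
  unfolding tightness_def
  using least_infinite_card(1,2)[of _ "tight_at Y y", OF Cinfinite_UNIV_plus tight_at_UNIV]
  by blast+

lemma tightness_least:
  fixes s :: "'d rel"
  assumes "Cinfinite s" "tight_at Y y s"
  shows "tightness Y y \<le>o s"
  unfolding tightness_def
  by (rule least_infinite_card_all_types[of "tight_at Y y", OF tight_at_UNIV assms(1) tight_at_mono[OF assms(2)]])

lemma alpha_Lindelof_UNIV:
  "alpha_Lindelof X \<alpha> (U :: 'a set) |UNIV :: ('a set + nat) set|"
  unfolding alpha_Lindelof_def using card_of_ordLeq_UNIV_plus by blast

lemma alpha_Lindelof_mono: "alpha_Lindelof X \<alpha> U s \<Longrightarrow> s \<le>o r \<Longrightarrow> alpha_Lindelof X \<alpha> U r"
  unfolding alpha_Lindelof_def by (metis ordLeq_transitive)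

lemma alpha_Lindelof_number:
  "Cinfinite (alpha_Lindelof_number X \<alpha> U)"
  "alpha_Lindelof X \<alpha> U (alpha_Lindelof_number X \<alpha> U)"
  unfolding alpha_Lindelof_number_def
  using least_infinite_card(1,2)[of _ "alpha_Lindelof X \<alpha> U",
      OF Cinfinite_UNIV_plus alpha_Lindelof_UNIV]
  by blast+

lemma alpha_Lindelof_number_least:
  fixes s :: "'d rel"
  assumes "Cinfinite s" "alpha_Lindelof X \<alpha> U s"
  shows "alpha_Lindelof_number X \<alpha> U \<le>o s"
  unfolding alpha_Lindelof_number_def
  by (rule least_infinite_card_all_types[of "alpha_Lindelof X \<alpha> U", OF alpha_Lindelof_UNIV assms(1) alpha_Lindelof_mono[OF assms(2)]])

lemma topspace_C_alpha:
  assumes "topspace \<alpha> = opens X"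
  shows "topspace (C_alpha X \<alpha>) = cont_real X"
proof -
  have "openin \<alpha> (opens X)"
    using assms by (metis openin_topspace)
  moreover have "fun_subbasic X (opens X) UNIV = cont_real X"
    by (auto simp: fun_subbasic_def opens_def)
  ultimately have "cont_real X \<in> {fun_subbasic X \<A> U |\<A> U. openin \<alpha> \<A> \<and> open U}"
    by (metis (mono_tags, lifting) mem_Collect_eq open_UNIV)
  then show ?thesis
    unfolding C_alpha_def by (auto simp: topology_generated_by_topspace fun_subbasic_def)
qed

end

theory Submission
  imports Defs
begin

text \<open>
  A family of open sets is an \<open>\<alpha>\<close>-cover of \<open>U\<close> exactly when \<open>U\<close> lies in its closure in
  \<open>\<alpha>(X,$)\<close>, so the first equality only renames one cardinal function as another
  (\<open>alpha_cover_iff_closure\<close>).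

  For the second equality, the members of \<open>\<alpha>\<close> are closed under open supersets, hence the zero
  function has the sets \<open>{f. {x. \<bar>f x\<bar> < \<epsilon>} \<in> \<A>}\<close>, with \<open>X \<in> \<A> \<in> \<alpha>\<close> and \<open>\<epsilon> > 0\<close>, as a
  neighbourhood base.  So it lies in the closure of a set \<open>A\<close> of functions iff for every \<open>\<epsilon> > 0\<close>
  the sets \<open>{x. \<bar>f x\<bar> < \<epsilon>}\<close> with \<open>f \<in> A\<close> form an \<open>\<alpha>\<close>-cover of \<open>X\<close>
  (\<open>zero_fun_in_closure_iff\<close>).  This gives both inequalities.

  If every \<open>\<alpha>\<close>-cover of \<open>X\<close> has a subcover of size at most an infinite cardinal \<open>\<lambda>\<close>, thin out
  these covers for each \<open>\<epsilon> = 1/(n+1)\<close>; the union of the countably many sets of at most \<open>\<lambda>\<close>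
  functions still has at most \<open>\<lambda>\<close> elements and the zero function in its closure.

  Conversely, turn an \<open>\<alpha>\<close>-cover \<open>\<P>\<close> into the set of functions that are \<open>1\<close> off some
  \<open>U \<in> \<P>\<close>.  Complete regularity covers \<open>U \<in> \<A>\<close> by sets \<open>{x. f x < \<epsilon>}\<close> of nonnegative
  such functions; compactness of \<open>\<A>\<close> leaves finitely many, and their minimum is one function with
  \<open>{x. f x < \<epsilon>} \<in> \<A>\<close> (\<open>compact_family_shrink\<close>).  So the zero function is in the closure of this
  set of functions.  A function that is \<open>1\<close> off \<open>U\<close> has \<open>{x. \<bar>f x\<bar> < 1} \<subseteq> U\<close>, so a small set
  of functions with the zero function in its closure yields a small subcover.
\<close>

section \<open>Compact families and \<open>\<alpha>\<close>-covers\<close>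

lemma compact_family_upward:
  assumes "compact_family X \<A>" "V \<in> \<A>" "V \<subseteq> W" "openin X W"
  shows "W \<in> \<A>"
proof -
  have "\<A> = nbhds_fam X \<A>"
    using assms(1) by (simp add: compact_family_def)
  moreover have "W \<in> nbhds_fam X \<A>"
    using assms unfolding nbhds_fam_def nbhds_def by blast
  ultimately show ?thesis by simp
qed

lemma alpha_cover_iff_closure:
  assumes "topspace \<alpha> = opens X" "openin X U"
  shows "alpha_cover X \<alpha> U \<P> \<longleftrightarrow> \<P> \<subseteq> topspace \<alpha> \<and> U \<in> \<alpha> closure_of \<P>"
  using assms by (auto simp: alpha_cover_def in_closure_of opens_def)

lemma alpha_Lindelof_iff_tight_at:
  assumes "topspace \<alpha> = opens X" "openin X U"
  shows "alpha_Lindelof X \<alpha> U r \<longleftrightarrow> tight_at \<alpha> U r"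
  unfolding alpha_Lindelof_def tight_at_def alpha_cover_iff_closure[OF assms]
  by (meson subset_trans)

section \<open>Neighbourhoods and closure of the zero function\<close>

definition sublevel :: "'a topology \<Rightarrow> real \<Rightarrow> ('a \<Rightarrow> real) \<Rightarrow> 'a set" where
  "sublevel X \<epsilon> f = {x \<in> topspace X. \<bar>f x\<bar> < \<epsilon>}"

lemma openin_preimage_cont_real:
  assumes "f \<in> cont_real X" "open U"
  shows "openin X {x \<in> topspace X. f x \<in> U}"
  using assms by (auto simp: cont_real_def intro: openin_continuous_map_preimage)

lemma sublevel_eq_preimage: "sublevel X \<epsilon> f = {x \<in> topspace X. f x \<in> {-\<epsilon><..<\<epsilon>}}"
  by (auto simp: sublevel_def abs_less_iff)

lemma openin_sublevel: "f \<in> cont_real X \<Longrightarrow> openin X (sublevel X \<epsilon> f)"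
  unfolding sublevel_eq_preimage by (rule openin_preimage_cont_real) auto

lemma zero_fun_in_cont_real: "zero_fun X \<in> cont_real X"
  unfolding cont_real_def zero_fun_def
  by (simp add: continuous_map_eq[of X euclideanreal "\<lambda>x. 0"])

text \<open>
  Finitely many subbasic conditions \<open>f -` U\<^sub>i \<in> \<A>\<^sub>i\<close> satisfied by the zero function reduce to one
  member of \<open>\<alpha>\<close> and one \<open>\<epsilon>\<close>: intersect the families \<open>\<A>\<^sub>i\<close> and take the least radius; shrinking
  the radius is harmless because members of \<open>\<alpha>\<close> contain all open supersets of their elements.
\<close>

lemma C_alpha_zero_nbhd:
  assumes comp: "\<And>\<A>. openin \<alpha> \<A> \<Longrightarrow> compact_family X \<A>"
    and W: "openin (C_alpha X \<alpha>) W" "zero_fun X \<in> W"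
  shows "\<exists>\<A> \<epsilon>. openin \<alpha> \<A> \<and> topspace X \<in> \<A> \<and> \<epsilon> > 0 \<and>
           {f \<in> cont_real X. sublevel X \<epsilon> f \<in> \<A>} \<subseteq> W"
proof -
  have "generate_topology_on {fun_subbasic X \<A> U |\<A> U. openin \<alpha> \<A> \<and> open U} W"
    using W(1) unfolding C_alpha_def openin_topology_generated_by_iff .
  then show ?thesis
    using W(2)
  proof (induction rule: generate_topology_on.induct)
    case Empty
    then show ?case by simp
  next
    case (Int V W)
    then obtain \<A> \<epsilon> \<B> \<delta> where
      V: "openin \<alpha> \<A>" "topspace X \<in> \<A>" "\<epsilon> > 0" "{f \<in> cont_real X. sublevel X \<epsilon> f \<in> \<A>} \<subseteq> V" and
      W: "openin \<alpha> \<B>" "topspace X \<in> \<B>" "\<delta> > 0" "{f \<in> cont_real X. sublevel X \<delta> f \<in> \<B>} \<subseteq> W"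
      by blast
    have "sublevel X \<epsilon> f \<in> \<A> \<and> sublevel X \<delta> f \<in> \<B>"
      if f: "f \<in> cont_real X" and mem: "sublevel X (min \<epsilon> \<delta>) f \<in> \<A> \<inter> \<B>" for f
    proof -
      have "sublevel X (min \<epsilon> \<delta>) f \<subseteq> sublevel X \<epsilon> f" "sublevel X (min \<epsilon> \<delta>) f \<subseteq> sublevel X \<delta> f"
        by (auto simp: sublevel_def)
      then show ?thesis
        using mem compact_family_upward[OF comp[OF V(1)] _ _ openin_sublevel[OF f]]
          compact_family_upward[OF comp[OF W(1)] _ _ openin_sublevel[OF f]] by blast
    qed
    then have "{f \<in> cont_real X. sublevel X (min \<epsilon> \<delta>) f \<in> \<A> \<inter> \<B>} \<subseteq> V \<inter> W"
      using V(4) W(4) by blast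
    with V(1-3) W(1-3) show ?case
      by (intro exI[of _ "\<A> \<inter> \<B>"] exI[of _ "min \<epsilon> \<delta>"]) auto
  next
    case (UN \<K>)
    then obtain K where K: "K \<in> \<K>" "zero_fun X \<in> K" by blast
    from UN.IH[OF this] obtain \<A> \<epsilon> where "openin \<alpha> \<A>" "topspace X \<in> \<A>" "\<epsilon> > 0"
      "{f \<in> cont_real X. sublevel X \<epsilon> f \<in> \<A>} \<subseteq> K"
      by blast
    with K(1) show ?case by blast
  next
    case (Basis W)
    then obtain \<A> U where \<A>: "openin \<alpha> \<A>" and U: "open U" and W: "W = fun_subbasic X \<A> U"
      by blast
    let ?Z = "{x \<in> topspace X. zero_fun X x \<in> U}"
    have Z: "?Z \<in> \<A>"
      using Basis.prems W by (simp add: fun_subbasic_def)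
    \<comment> \<open>If \<open>0 \<notin> U\<close>, then the empty set is in \<open>\<A>\<close> and every \<open>\<epsilon>\<close> will do.\<close>
    obtain \<epsilon> where \<epsilon>: "\<epsilon> > 0" "0 \<in> U \<Longrightarrow> {-\<epsilon><..<\<epsilon>} \<subseteq> U"
    proof (cases "0 \<in> U")
      case True
      with U obtain e where "e > 0" "\<forall>y. dist y 0 < e \<longrightarrow> y \<in> U"
        unfolding open_dist by blast
      then show ?thesis
        by (intro that[of e]) (auto simp: dist_real_def)
    next
      case False
      then show ?thesis
        by (intro that[of 1]) auto
    qed
    have "f \<in> W" if f: "f \<in> cont_real X" "sublevel X \<epsilon> f \<in> \<A>" for f
    proof -
      let ?P = "{x \<in> topspace X. f x \<in> U}"
      have "sublevel X \<epsilon> f \<subseteq> ?P \<or> ?Z \<subseteq> ?P"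
        using \<epsilon>(2) by (cases "0 \<in> U") (auto simp: sublevel_eq_preimage zero_fun_def)
      then have "?P \<in> \<A>"
        using compact_family_upward[OF comp[OF \<A>] _ _ openin_preimage_cont_real[OF f(1) U]] f(2) Z
        by blast
      with f(1) W show ?thesis by (simp add: fun_subbasic_def)
    qed
    moreover have "topspace X \<in> \<A>"
      by (rule compact_family_upward[OF comp[OF \<A>] Z]) auto
    ultimately show ?case
      using \<A> \<epsilon>(1) by blast
  qed
qed

lemma openin_C_alpha_sublevel:
  assumes "openin \<alpha> \<A>"
  shows "openin (C_alpha X \<alpha>) {f \<in> cont_real X. sublevel X \<epsilon> f \<in> \<A>}"
proof -
  have "{f \<in> cont_real X. sublevel X \<epsilon> f \<in> \<A>} = fun_subbasic X \<A> {-\<epsilon><..<\<epsilon>}"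
    by (simp add: fun_subbasic_def sublevel_eq_preimage)
  moreover have "open {-\<epsilon><..<\<epsilon>}" by simp
  ultimately show ?thesis
    unfolding C_alpha_def using assms by (intro topology_generated_by_Basis) blast
qed

lemma zero_fun_in_closure_iff:
  assumes comp: "\<And>\<A>. openin \<alpha> \<A> \<Longrightarrow> compact_family X \<A>"
    and top: "topspace \<alpha> = opens X"
    and A: "A \<subseteq> cont_real X"
  shows "zero_fun X \<in> C_alpha X \<alpha> closure_of A \<longleftrightarrow>
           (\<forall>\<epsilon>>0. alpha_cover X \<alpha> (topspace X) (sublevel X \<epsilon> ` A))"
proof
  assume cl: "zero_fun X \<in> C_alpha X \<alpha> closure_of A"
  show "\<forall>\<epsilon>>0. alpha_cover X \<alpha> (topspace X) (sublevel X \<epsilon> ` A)"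
  proof (intro allI impI)
    fix \<epsilon> :: real assume "\<epsilon> > 0"
    have "sublevel X \<epsilon> ` A \<inter> \<A> \<noteq> {}" if \<A>: "openin \<alpha> \<A>" "topspace X \<in> \<A>" for \<A>
    proof -
      have "sublevel X \<epsilon> (zero_fun X) = topspace X"
        using \<open>\<epsilon> > 0\<close> by (auto simp: sublevel_def zero_fun_def)
      then have "zero_fun X \<in> {f \<in> cont_real X. sublevel X \<epsilon> f \<in> \<A>}"
        using \<A>(2) zero_fun_in_cont_real by auto
      then have "\<exists>f. f \<in> A \<and> f \<in> {f \<in> cont_real X. sublevel X \<epsilon> f \<in> \<A>}"
        using cl openin_C_alpha_sublevel[OF \<A>(1), of X \<epsilon>] unfolding in_closure_of by meson
      then show ?thesis by auto
    qed
    then show "alpha_cover X \<alpha> (topspace X) (sublevel X \<epsilon> ` A)"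
      using A openin_sublevel[of _ X \<epsilon>] by (auto simp: alpha_cover_def opens_def)
  qed
next
  assume cov: "\<forall>\<epsilon>>0. alpha_cover X \<alpha> (topspace X) (sublevel X \<epsilon> ` A)"
  show "zero_fun X \<in> C_alpha X \<alpha> closure_of A"
    unfolding in_closure_of
  proof (intro conjI allI impI)
    show "zero_fun X \<in> topspace (C_alpha X \<alpha>)"
      by (simp add: topspace_C_alpha[OF top] zero_fun_in_cont_real)
  next
    fix W assume "zero_fun X \<in> W \<and> openin (C_alpha X \<alpha>) W"
    then obtain \<A> \<epsilon> where \<A>: "openin \<alpha> \<A>" "topspace X \<in> \<A>" "\<epsilon> > 0"
      "{f \<in> cont_real X. sublevel X \<epsilon> f \<in> \<A>} \<subseteq> W"
      using C_alpha_zero_nbhd[of \<alpha> X W, OF comp] by auto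
    then have "sublevel X \<epsilon> ` A \<inter> \<A> \<noteq> {}"
      using cov unfolding alpha_cover_def by blast
    then show "\<exists>f. f \<in> A \<and> f \<in> W"
      using \<A>(4) A by blast
  qed
qed

section \<open>Shrinking an open set to a sublevel set\<close>

text \<open>
  The sublevel sets of nonnegative continuous functions that are \<open>1\<close> off \<open>U\<close> cover \<open>U\<close> by complete
  regularity.  Finitely many of them suffice for \<open>\<A>\<close> by compactness, and the pointwise minimum
  of finitely many such functions is another one, whose sublevel set is their union.
\<close>

lemma compact_family_shrink:
  assumes cr: "completely_regular_space X" and comp: "compact_family X \<A>"
    and U: "U \<in> \<A>" and \<epsilon>: "\<epsilon> > 0"
  shows "\<exists>f \<in> cont_real X. (\<forall>x \<in> topspace X - U. f x = 1) \<and> sublevel X \<epsilon> f \<in> \<A>"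
proof -
  define F where "F = {f. continuous_map X euclideanreal f \<and> (\<forall>x\<in>topspace X. 0 \<le> f x) \<and>
                         (\<forall>x \<in> topspace X - U. f x = 1)}"
  have U_open: "openin X U"
    using U comp by (auto simp: compact_family_def opens_def)
  have cont: "restrict f (topspace X) \<in> cont_real X" if "f \<in> F" for f
    using that by (auto simp: F_def cont_real_def intro: continuous_map_eq)
  have sub_restrict: "sublevel X \<epsilon> (restrict f (topspace X)) = sublevel X \<epsilon> f" for f
    by (auto simp: sublevel_def)
  have F_open: "openin X (sublevel X \<epsilon> f)" if "f \<in> F" for f
    using openin_sublevel[OF cont[OF that], of \<epsilon>] by (simp add: sub_restrict)
  \<comment> \<open>Complete regularity gives, for each \<open>x \<in> U\<close>, a function in \<open>F\<close> vanishing at \<open>x\<close>.\<close>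
  have U_sub: "U \<subseteq> \<Union>(sublevel X \<epsilon> ` F)"
  proof
    fix x assume x: "x \<in> U"
    moreover have "U \<subseteq> topspace X" "closedin X (topspace X - U)"
      using U_open by (auto simp: openin_subset)
    ultimately obtain f where f: "continuous_map X (top_of_set {0..1::real}) f" "f x = 0"
        "f ` (topspace X - U) \<subseteq> {1}"
      using cr unfolding completely_regular_space_def by (metis DiffD2 DiffI subsetD)
    then have "f \<in> F"
      by (auto simp: F_def continuous_map_in_subtopology)
    moreover have "x \<in> sublevel X \<epsilon> f"
      using x f(2) \<epsilon> \<open>U \<subseteq> topspace X\<close> by (auto simp: sublevel_def)
    ultimately show "x \<in> \<Union>(sublevel X \<epsilon> ` F)" by blast
  qed
  have Q: "sublevel X \<epsilon> ` F \<subseteq> opens X"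
    using F_open by (auto simp: opens_def)
  then have "\<Union>(sublevel X \<epsilon> ` F) \<in> \<A>"
    using compact_family_upward[OF comp U U_sub] by (auto simp: opens_def)
  with Q obtain \<S> where \<S>: "finite \<S>" "\<S> \<subseteq> sublevel X \<epsilon> ` F" "\<Union>\<S> \<in> \<A>"
    using comp unfolding compact_family_def by meson
  \<comment> \<open>\<open>F\<close> is closed under \<open>min\<close>; nonnegativity turns a small value of \<open>f\<close> or \<open>g\<close> into a small
      absolute value of the minimum. The empty union is served by the constant \<open>1\<close>.\<close>
  from \<S>(1,2) have "\<exists>f\<in>F. \<Union>\<S> \<subseteq> sublevel X \<epsilon> f"
  proof (induction rule: finite_induct)
    case empty
    have "(\<lambda>x. 1) \<in> F" by (simp add: F_def)
    then show ?case by blast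
  next
    case (insert S \<S>)
    from insert.prems obtain g where g: "g \<in> F" "S = sublevel X \<epsilon> g"
      by auto
    from insert obtain f where f: "f \<in> F" "\<Union>\<S> \<subseteq> sublevel X \<epsilon> f"
      by auto
    have "(\<lambda>x. min (f x) (g x)) \<in> F"
      using f(1) g(1) by (auto simp: F_def intro: continuous_map_real_min)
    moreover have "\<Union>(insert S \<S>) \<subseteq> sublevel X \<epsilon> (\<lambda>x. min (f x) (g x))"
    proof -
      have "sublevel X \<epsilon> f \<union> sublevel X \<epsilon> g \<subseteq> sublevel X \<epsilon> (\<lambda>x. min (f x) (g x))"
        using f(1) g(1) by (auto simp: F_def sublevel_def)
      with f(2) g(2) show ?thesis by auto
    qed
    ultimately show ?case by blast
  qed
  then obtain f where f: "f \<in> F" "\<Union>\<S> \<subseteq> sublevel X \<epsilon> f" by (elim bexE)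
  have "sublevel X \<epsilon> f \<in> \<A>"
    by (rule compact_family_upward[OF comp \<S>(3) f(2) F_open[OF f(1)]])
  with f(1) show ?thesis
    by (intro bexI[OF _ cont[OF f(1)]]) (auto simp: sub_restrict F_def)
qed

section \<open>The two inequalities\<close>

lemma image_subset_card:
  assumes "R \<subseteq> g ` A" "|R| \<le>o r"
  obtains B where "B \<subseteq> A" "R = g ` B" "|B| \<le>o r"
proof -
  obtain B where "B \<subseteq> A" "inj_on g B" "R = g ` B"
    using assms(1) by (meson subset_image_inj)
  moreover have "|B| \<le>o |R|"
    using calculation by (intro card_of_ordLeqI[of g]) auto
  ultimately show ?thesis
    using that[of B] ordLeq_transitive[OF _ assms(2), of "|B|"] by metis
qed

text \<open>
  The thinned-out set \<open>B n\<close> controls only the radius \<open>1/(n+1)\<close>; the union over \<open>n\<close> controls all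
  radii, since a sublevel set for a smaller radius lies in the one for a larger radius.  This is
  where \<open>r\<close> has to be infinite.
\<close>

lemma tight_at_C_alpha_if_alpha_Lindelof:
  assumes comp: "\<And>\<A>. openin \<alpha> \<A> \<Longrightarrow> compact_family X \<A>"
    and top: "topspace \<alpha> = opens X"
    and r: "Cinfinite r" and L: "alpha_Lindelof X \<alpha> (topspace X) r"
  shows "tight_at (C_alpha X \<alpha>) (zero_fun X) r"
  unfolding tight_at_def topspace_C_alpha[OF top]
proof (intro allI impI)
  fix A assume A: "A \<subseteq> cont_real X \<and> zero_fun X \<in> C_alpha X \<alpha> closure_of A"
  have "\<exists>B. B \<subseteq> A \<and> |B| \<le>o r \<and> alpha_cover X \<alpha> (topspace X) (sublevel X (1 / real (Suc n)) ` B)"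
    for n :: nat
  proof -
    have "alpha_cover X \<alpha> (topspace X) (sublevel X (1 / real (Suc n)) ` A)"
      using A zero_fun_in_closure_iff[OF comp top, of A] by simp
    then obtain \<R> where "\<R> \<subseteq> sublevel X (1 / real (Suc n)) ` A" "|\<R>| \<le>o r"
      "alpha_cover X \<alpha> (topspace X) \<R>"
      using L unfolding alpha_Lindelof_def by blast
    with image_subset_card[of \<R> "sublevel X (1 / real (Suc n))" A r] show ?thesis
      by metis
  qed
  then obtain B where B: "B n \<subseteq> A" "|B n| \<le>o r"
    "alpha_cover X \<alpha> (topspace X) (sublevel X (1 / real (Suc n)) ` B n)" for n :: nat
    by metis
  have nat: "|UNIV :: nat set| \<le>o r"
    using r natLeq_ordLeq_cinfinite[OF r] card_of_nat ordIso_ordLeq_trans by blast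
  \<comment> \<open>A union of at most \<open>r\<close> many sets of size at most \<open>r\<close>, with \<open>r\<close> infinite.\<close>
  have "|\<Union>n. B n| \<le>o r"
    using r B(2) nat by (intro card_of_UNION_ordLeq_infinite_Field) (auto simp: cinfinite_def)
  moreover have "zero_fun X \<in> C_alpha X \<alpha> closure_of (\<Union>n. B n)"
  proof -
    have "alpha_cover X \<alpha> (topspace X) (sublevel X \<epsilon> ` (\<Union>n. B n))" if \<epsilon>: "\<epsilon> > 0" for \<epsilon>
      unfolding alpha_cover_def
    proof (intro conjI allI impI)
      show "sublevel X \<epsilon> ` (\<Union>n. B n) \<subseteq> opens X"
        using B(1) A openin_sublevel[of _ X \<epsilon>] by (fastforce simp: opens_def)
    next
      fix \<A> assume \<A>: "openin \<alpha> \<A> \<and> topspace X \<in> \<A>"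
      obtain n :: nat where n: "1 / real (Suc n) < \<epsilon>"
        using nat_approx_posE[OF \<epsilon>] .
      obtain f where f: "f \<in> B n" "sublevel X (1 / real (Suc n)) f \<in> \<A>"
        using B(3)[of n] \<A> unfolding alpha_cover_def by blast
      have "sublevel X (1 / real (Suc n)) f \<subseteq> sublevel X \<epsilon> f"
        using n by (auto simp: sublevel_def)
      moreover have "openin X (sublevel X \<epsilon> f)"
        using f(1) B(1) A openin_sublevel by blast
      ultimately have "sublevel X \<epsilon> f \<in> \<A>"
        using compact_family_upward[OF comp] \<A> f(2) by blast
      with f(1) show "sublevel X \<epsilon> ` (\<Union>n. B n) \<inter> \<A> \<noteq> {}" by blast
    qed
    moreover have "(\<Union>n. B n) \<subseteq> cont_real X"
      using B(1) A by blast
    ultimately show ?thesis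
      using zero_fun_in_closure_iff[OF comp top, of "\<Union>n. B n"] by simp
  qed
  moreover have "(\<Union>n. B n) \<subseteq> A"
    using B(1) by (rule UN_least)
  ultimately show "\<exists>B. B \<subseteq> A \<and> |B| \<le>o r \<and> zero_fun X \<in> C_alpha X \<alpha> closure_of B"
    by (intro exI[of _ "\<Union>n. B n"] conjI)
qed

text \<open>
  A cover becomes a set of functions by way of \<open>compact_family_shrink\<close>.  The way back only looks
  at radius \<open>1\<close>: a function that is \<open>1\<close> off \<open>U\<close> has its sublevel set for radius \<open>1\<close> inside \<open>U\<close>.
\<close>

lemma alpha_Lindelof_if_tight_at_C_alpha:
  assumes cr: "completely_regular_space X"
    and comp: "\<And>\<A>. openin \<alpha> \<A> \<Longrightarrow> compact_family X \<A>"
    and top: "topspace \<alpha> = opens X"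
    and t: "tight_at (C_alpha X \<alpha>) (zero_fun X) r"
  shows "alpha_Lindelof X \<alpha> (topspace X) r"
  unfolding alpha_Lindelof_def
proof (intro allI impI)
  fix \<P> assume \<P>: "alpha_cover X \<alpha> (topspace X) \<P>"
  define A where "A = {f \<in> cont_real X. \<exists>U\<in>\<P>. \<forall>x \<in> topspace X - U. f x = 1}"
  have A: "A \<subseteq> cont_real X" by (auto simp: A_def)
  have "alpha_cover X \<alpha> (topspace X) (sublevel X \<epsilon> ` A)" if \<epsilon>: "\<epsilon> > 0" for \<epsilon>
    unfolding alpha_cover_def
  proof (intro conjI allI impI)
    show "sublevel X \<epsilon> ` A \<subseteq> opens X"
      using A openin_sublevel[of _ X \<epsilon>] by (auto simp: opens_def)
  next
    fix \<A> assume \<A>: "openin \<alpha> \<A> \<and> topspace X \<in> \<A>"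
    then obtain U where U: "U \<in> \<P>" "U \<in> \<A>"
      using \<P> unfolding alpha_cover_def by blast
    then obtain f where "f \<in> cont_real X" "\<forall>x \<in> topspace X - U. f x = 1" "sublevel X \<epsilon> f \<in> \<A>"
      using compact_family_shrink[OF cr comp U(2) \<epsilon>] \<A> by blast
    with U(1) show "sublevel X \<epsilon> ` A \<inter> \<A> \<noteq> {}"
      unfolding A_def by blast
  qed
  then have "zero_fun X \<in> C_alpha X \<alpha> closure_of A"
    using zero_fun_in_closure_iff[OF comp top A] by simp
  then obtain B where B: "B \<subseteq> A" "|B| \<le>o r" "zero_fun X \<in> C_alpha X \<alpha> closure_of B"
    using t A unfolding tight_at_def topspace_C_alpha[OF top] by meson
  have "\<forall>f\<in>B. \<exists>U. U \<in> \<P> \<and> (\<forall>x \<in> topspace X - U. f x = 1)"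
    using B(1) unfolding A_def by auto
  then obtain u where u: "\<And>f. f \<in> B \<Longrightarrow> u f \<in> \<P> \<and> (\<forall>x \<in> topspace X - u f. f x = 1)"
    by (auto dest!: bchoice)
  have "alpha_cover X \<alpha> (topspace X) (u ` B)"
    unfolding alpha_cover_def
  proof (intro conjI allI impI)
    show "u ` B \<subseteq> opens X"
      using u \<P> unfolding alpha_cover_def by blast
  next
    fix \<A> assume \<A>: "openin \<alpha> \<A> \<and> topspace X \<in> \<A>"
    have "alpha_cover X \<alpha> (topspace X) (sublevel X 1 ` B)"
      using zero_fun_in_closure_iff[OF comp top subset_trans[OF B(1) A]] B(3) by simp
    then obtain f where f: "f \<in> B" "sublevel X 1 f \<in> \<A>"
      using \<A> unfolding alpha_cover_def by blast
    have "sublevel X 1 f \<subseteq> u f"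
      using u[OF f(1)] by (force simp: sublevel_def)
    moreover have "openin X (u f)"
      using u[OF f(1)] \<P> by (auto simp: alpha_cover_def opens_def)
    ultimately have "u f \<in> \<A>"
      using compact_family_upward[OF comp] \<A> f(2) by blast
    with f(1) show "u ` B \<inter> \<A> \<noteq> {}" by blast
  qed
  moreover have "|u ` B| \<le>o r"
    using card_of_image B(2) by (rule ordLeq_transitive)
  moreover have "u ` B \<subseteq> \<P>"
    using u by blast
  ultimately show "\<exists>\<R>\<subseteq>\<P>. |\<R>| \<le>o r \<and> alpha_cover X \<alpha> (topspace X) \<R>"
    by (intro exI[of _ "u ` B"] conjI)
qed

theorem theorem9p2:
  fixes X :: "'a topology" and \<alpha> :: "'a set topology"
  assumes "completely_regular_space X"
    and "topspace \<alpha> = opens X"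
    and "p_top X \<subseteq> {\<A>. openin \<alpha> \<A>}"
    and "{\<A>. openin \<alpha> \<A>} \<subseteq> kappa_top X"
  shows "alpha_Lindelof_number X \<alpha> (topspace X) =o tightness \<alpha> (topspace X)
       \<and> tightness \<alpha> (topspace X) =o tightness (C_alpha X \<alpha>) (zero_fun X)"
proof -
  let ?L = "alpha_Lindelof_number X \<alpha> (topspace X)"
  let ?t = "tightness (C_alpha X \<alpha>) (zero_fun X)"
  have comp: "compact_family X \<A>" if "openin \<alpha> \<A>" for \<A>
    using assms(4) that by (auto simp: kappa_top_def)
  have eq: "?L = tightness \<alpha> (topspace X)"
    unfolding alpha_Lindelof_number_def tightness_def
    using alpha_Lindelof_iff_tight_at[OF assms(2) openin_topspace]
    by (intro arg_cong[of _ _ least_infinite_card]) blast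
  have "?t \<le>o ?L"
    by (intro tightness_least tight_at_C_alpha_if_alpha_Lindelof alpha_Lindelof_number
        comp assms(2))
  moreover have "?L \<le>o ?t"
    by (intro alpha_Lindelof_number_least alpha_Lindelof_if_tight_at_C_alpha tightness
        comp assms(1,2))
  ultimately have "?L =o ?t"
    using ordIso_iff_ordLeq by blast
  moreover have "?L =o ?L"
    using alpha_Lindelof_number(1) card_order_on_well_order_on ordIso_reflexive by metis
  ultimately show ?thesis
    using eq by simp
qed

end
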